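(* Let $(D,\prec_\lambda,\succ_\lambda,\alpha,\beta)$ be a BiHom-dendriform conformal algebra and let $(D,\prec_\lambda,\succ_\lambda,\alpha,\beta,R,S)$ be a Rota-Baxter system on it. Define operations on $D$ by $p\searrow_\lambda^R q=R(p)\succ_\lambda q$, $p\nearrow_\lambda^R q=p\succ_\lambda S(q)$, $p\swarrow_\lambda^R q=R(p)\prec_\lambda q$ and $p\nwarrow_\lambda^R q=p\prec_\lambda S(q)$ for all $p,q\in D$. Then $(D,\nwarrow_\lambda^R,\swarrow_\lambda^R,\nearrow_\lambda^R,\searrow_\lambda^R,\alpha,\beta)$ is a BiHom-quadri-conformal algebra.
   Context: All vector spaces, linear maps and tensor products are over $\mathbb{C}$; $\lambda,\mu$ are formal variables. For a $\mathbb{C}[\partial]$-module $A$ put $A[\lambda]=\mathbb{C}[\lambda]\otimes A$. A $\mathbb{C}$-bilinear map $A\otimes A\to A[\lambda]$, $p\otimes q\mapsto p\circ_\lambda q$, is conformal sesquilinear if $(\partial p)\circ_\lambda q=-\lambda(p\circ_\lambda q)$ and $p\circ_\lambda(\partial q)=(\partial+\lambda)(p\circ_\lambda q)$. Linear maps and products are extended coefficientwise to polynomials in $\lambda,\mu$; e.g. if $p\circ_\lambda q=\sum_i\lambda^i a_i$ then $(p\circ_\lambda q)\circ_{\lambda+\mu}r=\sum_i\lambda^i(a_i\circ_{\lambda+\mu}r)$. A map $\alpha$ is multiplicative for $\circ_\lambda$ if $\alpha(p\circ_\lambda q)=\alpha(p)\circ_\lambda\alpha(q)$. A BiHom-dendriform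 conformal algebra $(D,\prec_\lambda,\succ_\lambda,\alpha,\beta)$ is a $\mathbb{C}[\partial]$-module $D$ with conformal sesquilinear maps $\prec_\lambda,\succ_\lambda:D\otimes D\to D[\lambda]$ and commuting $\mathbb{C}$-linear maps $\alpha,\beta:D\to D$ commuting with $\partial$ and multiplicative for both products, such that for all $p,q,r\in D$: $(p\prec_\lambda q)\prec_{\lambda+\mu}\beta(r)=\alpha(p)\prec_\lambda(q\prec_\mu r+q\succ_\mu r)$; $(p\succ_\lambda q)\prec_{\lambda+\mu}\beta(r)=\alpha(p)\succ_\lambda(q\prec_\mu r)$; $\alpha(p)\succ_\lambda(q\succ_\mu r)=(p\prec_\lambda q+p\succ_\lambda q)\succ_{\lambda+\mu}\beta(r)$. A Rota-Baxter system $(D,\prec_\lambda,\succ_\lambda,\alpha,\beta,R,S)$ on a BiHom-dendriform conformal algebra consists of $\mathbb{C}[\partial]$-linear maps $R,S:D\to D$ commuting with $\alpha$ and $\beta$ such that for all $p,q\in D$: $R(p)\succ_\lambda R(q)=R(p\succ_\lambda S(q)+R(p)\succ_\lambda q)$; $R(p)\prec_\lambda R(q)=R(p\prec_\lambda S(q)+R(p)\prec_\lambda q)$; $S(p)\succ_\lambda S(q)=S(p\succ_\lambda S(q)+R(p)\succ_\lambda q)$; $S(p)\prec_\lambda S(q)=S(p\prec_\lambda S(q)+R(p)\prec_\lambda q)$. A BiHom-quadri-conformal algebra $(Q,\nwarrow_\lambda,\swarrow_\lambda,\nearrow_\lambda,\searrow_\lambda,\alpha,\beta)$ is a $\mathbb{C}[\partial]$-module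 $Q$ with four conformal sesquilinear maps $\nwarrow_\lambda,\swarrow_\lambda,\nearrow_\lambda,\searrow_\lambda:Q\otimes Q\to Q[\lambda]$ and commuting $\mathbb{C}$-linear maps $\alpha,\beta:Q\to Q$ commuting with $\partial$ and multiplicative for all four products, such that, writing (in $Q$) $p\prec_\lambda q=p\nwarrow_\lambda q+p\swarrow_\lambda q$, $p\succ_\lambda q=p\nearrow_\lambda q+p\searrow_\lambda q$, $p\vee_\lambda q=p\searrow_\lambda q+p\swarrow_\lambda q$, $p\wedge_\lambda q=p\nearrow_\lambda q+p\nwarrow_\lambda q$ and $p*_\lambda q=p\nwarrow_\lambda q+p\swarrow_\lambda q+p\nearrow_\lambda q+p\searrow_\lambda q$, for all $p,q,r\in Q$: $(p\nwarrow_\lambda q)\nwarrow_{\lambda+\mu}\beta(r)=\alpha(p)\nwarrow_\lambda(q*_\mu r)$; $(p\nearrow_\lambda q)\nwarrow_{\lambda+\mu}\beta(r)=\alpha(p)\nearrow_\lambda(q\prec_\mu r)$; $(p\wedge_\lambda q)\nearrow_{\lambda+\mu}\beta(r)=\alpha(p)\nearrow_\lambda(q\succ_\mu r)$; $(p\swarrow_\lambda q)\nwarrow_{\lambda+\mu}\beta(r)=\alpha(p)\swarrow_\lambda(q\wedge_\mu r)$; $(p\vee_\lambda q)\nearrow_{\lambda+\mu}\beta(r)=\alpha(p)\searrow_\lambda(q\nearrow_\mu r)$; $(p\searrow_\lambda q)\nwarrow_{\lambda+\mu}\beta(r)=\alpha(p)\searrow_\lambda(q\nwarrow_\mu r)$;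 $(p\prec_\lambda q)\swarrow_{\lambda+\mu}\beta(r)=\alpha(p)\swarrow_\lambda(q\vee_\mu r)$; $(p*_\lambda q)\searrow_{\lambda+\mu}\beta(r)=\alpha(p)\searrow_\lambda(q\searrow_\mu r)$; $(p\succ_\lambda q)\swarrow_{\lambda+\mu}\beta(r)=\alpha(p)\searrow_\lambda(q\swarrow_\mu r)$. *)

theory Defs
  imports Complex_Main "HOL-Computational_Algebra.Polynomial"
begin

text \<open>
  A \<open>\<complex>[\<partial>]\<close>-module is a module over the ring \<^typ>\<open>complex poly\<close>, given by its scalar multiplication
  \<open>scale\<close>.  The polynomial ring variable is \<open>\<partial>\<close>, and constants act as complex scalars.
\<close>

definition deriv_op :: "(complex poly \<Rightarrow> 'a \<Rightarrow> 'a) \<Rightarrow> 'a \<Rightarrow> 'a"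
  where "deriv_op scale p = scale [:0, 1:] p"

definition cscale :: "(complex poly \<Rightarrow> 'a \<Rightarrow> 'a) \<Rightarrow> complex \<Rightarrow> 'a \<Rightarrow> 'a"
  where "cscale scale c p = scale [:c:] p"

text \<open>
  \<open>A[\<lambda>]\<close> is \<^typ>\<open>'a poly\<close> (the coefficient type need not be a ring), with multiplication by \<open>\<lambda>\<close>
  given by \<open>pCons 0\<close> and coefficientwise extension of a linear map \<open>f\<close> given by \<open>map_poly f\<close>.
\<close>

definition cscale_poly ::
    "(complex poly \<Rightarrow> 'a \<Rightarrow> 'a) \<Rightarrow> complex \<Rightarrow> 'a::zero poly \<Rightarrow> 'a poly"
  where "cscale_poly scale c = map_poly (cscale scale c)"

text \<open>
  \<open>A[\<lambda>,\<mu>]\<close> is \<^typ>\<open>'a poly poly\<close> with outer variable \<open>\<mu>\<close> and inner variable \<open>\<lambda>\<close>: the coefficient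
  of \<open>\<lambda>\<^sup>i \<mu>\<^sup>j\<close> in \<open>F\<close> is \<open>coeff (coeff F j) i\<close>.
\<close>

definition mult_lambda :: "'a::zero poly poly \<Rightarrow> 'a poly poly"
  where "mult_lambda F = map_poly (pCons 0) F"

definition mult_mu :: "'a::zero poly poly \<Rightarrow> 'a poly poly"
  where "mult_mu F = pCons 0 F"

definition mult_lambda_mu :: "'a::ab_group_add poly poly \<Rightarrow> 'a poly poly"
  where "mult_lambda_mu F = mult_lambda F + mult_mu F"

text \<open>Substitution of \<open>\<lambda> + \<mu>\<close> for the variable of a polynomial in one variable.\<close>

definition subst_lambda_mu :: "'a::ab_group_add poly \<Rightarrow> 'a poly poly"
  where "subst_lambda_mu f = (\<Sum>j\<le>degree f. (mult_lambda_mu ^^ j) [:[:coeff f j:]:])"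

text \<open>
  For a product \<open>op\<close> standing for \<open>p \<circ>\<^sub>\<lambda> q\<close>:
  if \<open>f = \<Sum>i. \<lambda>\<^sup>i a\<^sub>i\<close> then \<open>lprod op f r\<close> is \<open>f \<circ>\<^bsub>\<lambda>+\<mu>\<^esub> r = \<Sum>i. \<lambda>\<^sup>i (a\<^sub>i \<circ>\<^bsub>\<lambda>+\<mu>\<^esub> r)\<close>, and
  if \<open>g = \<Sum>j. \<mu>\<^sup>j b\<^sub>j\<close> then \<open>rprod op p g\<close> is \<open>p \<circ>\<^sub>\<lambda> g = \<Sum>j. \<mu>\<^sup>j (p \<circ>\<^sub>\<lambda> b\<^sub>j)\<close>.
\<close>

definition lprod ::
    "('a \<Rightarrow> 'a \<Rightarrow> 'a poly) \<Rightarrow> 'a::ab_group_add poly \<Rightarrow> 'a \<Rightarrow> 'a poly poly"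
  where "lprod op f r =
    (\<Sum>i\<le>degree f. (mult_lambda ^^ i) (subst_lambda_mu (op (coeff f i) r)))"

definition rprod ::
    "('a \<Rightarrow> 'a \<Rightarrow> 'a poly) \<Rightarrow> 'a \<Rightarrow> 'a::ab_group_add poly \<Rightarrow> 'a poly poly"
  where "rprod op p g = map_poly (op p) g"

locale conformal_sesquilinear = module scale
  for scale :: "complex poly \<Rightarrow> 'a::ab_group_add \<Rightarrow> 'a" +
  fixes op :: "'a \<Rightarrow> 'a \<Rightarrow> 'a poly"
  assumes linear_left: "Vector_Spaces.linear (cscale scale) (cscale_poly scale) (\<lambda>p. op p q)"
    and linear_right: "Vector_Spaces.linear (cscale scale) (cscale_poly scale) (\<lambda>q. op p q)"
    and sesqui_left: "op (deriv_op scale p) q = - pCons 0 (op p q)"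
    and sesqui_right:
      "op p (deriv_op scale q) = map_poly (deriv_op scale) (op p q) + pCons 0 (op p q)"

definition multiplicative_for :: "('a \<Rightarrow> 'a) \<Rightarrow> ('a \<Rightarrow> 'a \<Rightarrow> 'a::zero poly) \<Rightarrow> bool"
  where "multiplicative_for \<alpha> op \<longleftrightarrow> (\<forall>p q. map_poly \<alpha> (op p q) = op (\<alpha> p) (\<alpha> q))"

locale bihom_structure_maps = module scale
  for scale :: "complex poly \<Rightarrow> 'a::ab_group_add \<Rightarrow> 'a" +
  fixes \<alpha> \<beta> :: "'a \<Rightarrow> 'a"
  assumes linear_alpha: "Vector_Spaces.linear (cscale scale) (cscale scale) \<alpha>"
    and linear_beta: "Vector_Spaces.linear (cscale scale) (cscale scale) \<beta>"
    and alpha_beta_commute: "\<alpha> (\<beta> p) = \<beta> (\<alpha> p)"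
    and alpha_deriv: "\<alpha> (deriv_op scale p) = deriv_op scale (\<alpha> p)"
    and beta_deriv: "\<beta> (deriv_op scale p) = deriv_op scale (\<beta> p)"

locale bihom_dendriform_conformal_algebra =
  bihom_structure_maps scale \<alpha> \<beta> +
  prec: conformal_sesquilinear scale prec +
  succ: conformal_sesquilinear scale succ
  for scale :: "complex poly \<Rightarrow> 'a::ab_group_add \<Rightarrow> 'a"
    and prec succ :: "'a \<Rightarrow> 'a \<Rightarrow> 'a poly"
    and \<alpha> \<beta> :: "'a \<Rightarrow> 'a" +
  assumes alpha_mult_prec: "multiplicative_for \<alpha> prec"
    and alpha_mult_succ: "multiplicative_for \<alpha> succ"
    and beta_mult_prec: "multiplicative_for \<beta> prec"
    and beta_mult_succ: "multiplicative_for \<beta> succ"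
    and dendriform1: "lprod prec (prec p q) (\<beta> r) = rprod prec (\<alpha> p) (prec q r + succ q r)"
    and dendriform2: "lprod prec (succ p q) (\<beta> r) = rprod succ (\<alpha> p) (prec q r)"
    and dendriform3: "rprod succ (\<alpha> p) (succ q r) = lprod succ (prec p q + succ p q) (\<beta> r)"

locale rota_baxter_system =
  bihom_dendriform_conformal_algebra scale prec succ \<alpha> \<beta> +
  R: module_hom scale scale R +
  S: module_hom scale scale S
  for scale :: "complex poly \<Rightarrow> 'a::ab_group_add \<Rightarrow> 'a"
    and prec succ :: "'a \<Rightarrow> 'a \<Rightarrow> 'a poly"
    and \<alpha> \<beta> R S :: "'a \<Rightarrow> 'a" +
  assumes R_alpha: "R (\<alpha> p) = \<alpha> (R p)"
    and R_beta: "R (\<beta> p) = \<beta> (R p)"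
    and S_alpha: "S (\<alpha> p) = \<alpha> (S p)"
    and S_beta: "S (\<beta> p) = \<beta> (S p)"
    and R_succ: "succ (R p) (R q) = map_poly R (succ p (S q) + succ (R p) q)"
    and R_prec: "prec (R p) (R q) = map_poly R (prec p (S q) + prec (R p) q)"
    and S_succ: "succ (S p) (S q) = map_poly S (succ p (S q) + succ (R p) q)"
    and S_prec: "prec (S p) (S q) = map_poly S (prec p (S q) + prec (R p) q)"

text \<open>
  The four products are named by compass directions: \<open>nw\<close> is \<open>\<nwarrow>\<close>, \<open>sw\<close> is \<open>\<swarrow>\<close>, \<open>ne\<close> is \<open>\<nearrow>\<close>
  and \<open>se\<close> is \<open>\<searrow>\<close>.
\<close>

locale bihom_quadri_conformal_algebra =
  bihom_structure_maps scale \<alpha> \<beta> +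
  nw: conformal_sesquilinear scale nw +
  sw: conformal_sesquilinear scale sw +
  ne: conformal_sesquilinear scale ne +
  se: conformal_sesquilinear scale se
  for scale :: "complex poly \<Rightarrow> 'a::ab_group_add \<Rightarrow> 'a"
    and nw sw ne se :: "'a \<Rightarrow> 'a \<Rightarrow> 'a poly"
    and \<alpha> \<beta> :: "'a \<Rightarrow> 'a" +
  assumes alpha_mult_nw: "multiplicative_for \<alpha> nw"
    and alpha_mult_sw: "multiplicative_for \<alpha> sw"
    and alpha_mult_ne: "multiplicative_for \<alpha> ne"
    and alpha_mult_se: "multiplicative_for \<alpha> se"
    and beta_mult_nw: "multiplicative_for \<beta> nw"
    and beta_mult_sw: "multiplicative_for \<beta> sw"
    and beta_mult_ne: "multiplicative_for \<beta> ne"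
    and beta_mult_se: "multiplicative_for \<beta> se"
    and quadri_nw_nw: "lprod nw (nw p q) (\<beta> r)
      = rprod nw (\<alpha> p) (nw q r + sw q r + ne q r + se q r)"
    and quadri_ne_nw: "lprod nw (ne p q) (\<beta> r) = rprod ne (\<alpha> p) (nw q r + sw q r)"
    and quadri_wedge_ne: "lprod ne (ne p q + nw p q) (\<beta> r) = rprod ne (\<alpha> p) (ne q r + se q r)"
    and quadri_sw_nw: "lprod nw (sw p q) (\<beta> r) = rprod sw (\<alpha> p) (ne q r + nw q r)"
    and quadri_vee_ne: "lprod ne (se p q + sw p q) (\<beta> r) = rprod se (\<alpha> p) (ne q r)"
    and quadri_se_nw: "lprod nw (se p q) (\<beta> r) = rprod se (\<alpha> p) (nw q r)"
    and quadri_prec_sw: "lprod sw (nw p q + sw p q) (\<beta> r) = rprod sw (\<alpha> p) (se q r + sw q r)"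
    and quadri_star_se: "lprod se (nw p q + sw p q + ne p q + se p q) (\<beta> r)
      = rprod se (\<alpha> p) (se q r)"
    and quadri_succ_sw: "lprod sw (ne p q + se p q) (\<beta> r) = rprod se (\<alpha> p) (sw q r)"

end

theory Submission
  imports Defs
begin

text \<open>
  Twisting a product in its second argument by \<open>S\<close> or in its first argument by \<open>R\<close> changes the
  extended products in a simple way: a twist by \<open>S\<close> moves \<open>S\<close> onto the right-hand factor of an outer
  product, a twist by \<open>R\<close> moves \<open>R\<close> onto the left-hand factor.  For a factor that is a polynomial
  this means applying the map coefficientwise (\<open>lprod_twist_left\<close> and \<open>rprod_twist_right\<close>).

  The four Rota-Baxter identities say that the coefficientwise images under \<open>R\<close> and \<open>S\<close> of the sums
  \<open>p \<prec> S(q) + R(p) \<prec> q\<close> and \<open>p \<succ> S(q) + R(p) \<succ> q\<close> are again plain dendriform products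
  (of \<open>R(p), R(q)\<close> or of \<open>S(p), S(q)\<close>).  Hence each quadri axiom, once its twists have been
  moved inside, is one of the three dendriform axioms at one of three triples.  The triple can be read
  off from the side \<open>(p \<circ> q) \<circ> \<beta>(r)\<close>: it is \<open>(p, S q, S r)\<close> if the inner and the outer product are
  both twisted by \<open>S\<close>, \<open>(R p, q, S r)\<close> if the inner one is twisted by \<open>R\<close> and the outer one by \<open>S\<close>,
  and \<open>(R p, R q, r)\<close> if the outer one is twisted by \<open>R\<close>.  Three dendriform axioms at three triples
  give the nine quadri axioms.

  The conditions on \<open>\<alpha>\<close> and \<open>\<beta>\<close> and sesquilinearity pass to the twisted products because \<open>R\<close> and
  \<open>S\<close> commute with \<open>\<alpha>\<close>, \<open>\<beta>\<close>, \<open>\<partial>\<close> and scalars.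
\<close>

lemma mult_lambda_funpow_0: "(mult_lambda ^^ i) 0 = 0"
  by (induction i) (simp_all add: mult_lambda_def)

lemma subst_lambda_mu_0: "subst_lambda_mu 0 = 0"
proof -
  have "mult_lambda_mu [:[:0:]:] = (0 :: 'a poly poly)"
    by (simp add: mult_lambda_mu_def mult_lambda_def mult_mu_def)
  then show ?thesis
    by (simp add: subst_lambda_mu_def)
qed

text \<open>
  The defining sum may run over any range containing the support, so that \<open>lprod\<close> of two polynomials
  of different degree can be compared term by term.
\<close>

lemma lprod_eq_sum_upto:
  assumes op_0: "op 0 r = 0" and deg: "degree f \<le> n"
  shows "lprod op f r = (\<Sum>i\<le>n. (mult_lambda ^^ i) (subst_lambda_mu (op (coeff f i) r)))"
  unfolding lprod_def
proof (rule sum.mono_neutral_left)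
  show "\<forall>i\<in>{..n} - {..degree f}.
      (mult_lambda ^^ i) (subst_lambda_mu (op (coeff f i) r)) = 0"
    by (auto simp: coeff_eq_0 op_0 subst_lambda_mu_0 mult_lambda_funpow_0)
qed (use deg in auto)

text \<open>
  If \<open>R\<close> kills leading coefficients, \<open>map_poly R f\<close> has smaller degree than \<open>f\<close>; the extra terms on the
  left then have the factor \<open>op 0 r = 0\<close>.
\<close>

lemma lprod_twist_left:
  assumes "R 0 = 0" and "op 0 r = 0"
  shows "lprod (\<lambda>p q. op (R p) q) f r = lprod op (map_poly R f) r"
proof -
  have "degree (map_poly R f) \<le> degree f"
    by (rule degree_le) (simp add: coeff_map_poly assms(1) coeff_eq_0)
  then have "lprod op (map_poly R f) r =
      (\<Sum>i\<le>degree f. (mult_lambda ^^ i) (subst_lambda_mu (op (R (coeff f i)) r)))"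
    using assms by (simp add: lprod_eq_sum_upto coeff_map_poly)
  then show ?thesis
    by (simp add: lprod_def)
qed

lemma rprod_twist_right:
  assumes "S 0 = 0" and "op p 0 = 0"
  shows "rprod (\<lambda>p q. op p (S q)) p g = rprod op p (map_poly S g)"
  using assms by (simp add: rprod_def map_poly_map_poly o_def)

lemma lprod_twist_right: "lprod (\<lambda>p q. op p (S q)) f r = lprod op f (S r)"
  by (simp add: lprod_def)

lemma rprod_twist_left: "rprod (\<lambda>p q. op (R p) q) p g = rprod op (R p) g"
  by (simp add: rprod_def)

lemma map_poly_add_hom:
  assumes "f 0 = 0" and "\<And>x y. f (x + y) = f x + f y"
  shows "map_poly f (p + q) = map_poly f p + map_poly f q"
  using assms by (intro poly_eqI) (simp add: coeff_map_poly)

text \<open>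
  A \<open>\<complex>[\<partial>]\<close>-linear map is in particular \<open>\<complex>\<close>-linear, so precomposition with it stays linear.
\<close>

lemma linear_compose_module_hom:
  assumes hom: "module_hom scale scale T"
    and lin: "Vector_Spaces.linear (cscale scale) s f"
  shows "Vector_Spaces.linear (cscale scale) s (\<lambda>p. f (T p))"
proof -
  interpret T: module_hom scale scale T by fact
  interpret f: Vector_Spaces.linear "cscale scale" s f by fact
  have "Vector_Spaces.linear (cscale scale) (cscale scale) T"
    by unfold_locales (simp_all add: T.add T.scale cscale_def)
  from Vector_Spaces.linear_compose[OF this lin] show ?thesis
    by (simp add: o_def)
qed

context conformal_sesquilinear
begin

lemma op_0_left: "op 0 q = 0"
proof -
  interpret l: Vector_Spaces.linear "cscale scale" "cscale_poly scale" "\<lambda>p. op p q"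
    by (rule linear_left)
  show ?thesis by (rule l.zero)
qed

lemma op_0_right: "op p 0 = 0"
proof -
  interpret l: Vector_Spaces.linear "cscale scale" "cscale_poly scale" "\<lambda>q. op p q"
    by (rule linear_right)
  show ?thesis by (rule l.zero)
qed

lemma conformal_sesquilinear_twist_left:
  assumes "module_hom scale scale T"
  shows "conformal_sesquilinear scale (\<lambda>p q. op (T p) q)"
proof -
  interpret T: module_hom scale scale T by fact
  have T_deriv: "T (deriv_op scale p) = deriv_op scale (T p)" for p
    by (simp add: deriv_op_def T.scale)
  show ?thesis
    by (intro conformal_sesquilinear.intro conformal_sesquilinear_axioms.intro module_axioms)
      (simp_all add: T_deriv sesqui_left sesqui_right linear_right
        linear_compose_module_hom[OF assms linear_left])
qed

lemma conformal_sesquilinear_twist_right: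
  assumes "module_hom scale scale T"
  shows "conformal_sesquilinear scale (\<lambda>p q. op p (T q))"
proof -
  interpret T: module_hom scale scale T by fact
  have T_deriv: "T (deriv_op scale p) = deriv_op scale (T p)" for p
    by (simp add: deriv_op_def T.scale)
  show ?thesis
    by (intro conformal_sesquilinear.intro conformal_sesquilinear_axioms.intro module_axioms)
      (simp_all add: T_deriv sesqui_left sesqui_right linear_left
        linear_compose_module_hom[OF assms linear_right])
qed

end

lemma multiplicative_for_twist_left:
  assumes "multiplicative_for \<alpha> op" and "\<And>p. T (\<alpha> p) = \<alpha> (T p)"
  shows "multiplicative_for \<alpha> (\<lambda>p q. op (T p) q)"
  using assms by (simp add: multiplicative_for_def)

lemma multiplicative_for_twist_right:
  assumes "multiplicative_for \<alpha> op" and "\<And>p. T (\<alpha> p) = \<alpha> (T p)"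
  shows "multiplicative_for \<alpha> (\<lambda>p q. op p (T q))"
  using assms by (simp add: multiplicative_for_def)

theorem proposition5p9:
  fixes scale :: "complex poly \<Rightarrow> 'a::ab_group_add \<Rightarrow> 'a"
    and prec succ :: "'a \<Rightarrow> 'a \<Rightarrow> 'a poly"
    and \<alpha> \<beta> R S :: "'a \<Rightarrow> 'a"
  assumes "bihom_dendriform_conformal_algebra scale prec succ \<alpha> \<beta>"
    and "rota_baxter_system scale prec succ \<alpha> \<beta> R S"
  shows "bihom_quadri_conformal_algebra scale
    (\<lambda>p q. prec p (S q)) (\<lambda>p q. prec (R p) q)
    (\<lambda>p q. succ p (S q)) (\<lambda>p q. succ (R p) q) \<alpha> \<beta>"
proof -
  interpret rota_baxter_system scale prec succ \<alpha> \<beta> R S by fact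
  note hom_R = R.module_hom_axioms and hom_S = S.module_hom_axioms
  note map_R_add = map_poly_add_hom[of R, OF R.zero R.add]
    and map_S_add = map_poly_add_hom[of S, OF S.zero S.add]
  \<comment> \<open>The product is named in each rule, since a higher-order variable in its place would match
    too many terms.\<close>
  note twists =
    lprod_twist_right[of prec S] lprod_twist_right[of succ S]
    rprod_twist_left[of prec R] rprod_twist_left[of succ R]
    lprod_twist_left[of R prec, OF R.zero prec.op_0_left]
    lprod_twist_left[of R succ, OF R.zero succ.op_0_left]
    rprod_twist_right[of S prec, OF S.zero prec.op_0_right]
    rprod_twist_right[of S succ, OF S.zero succ.op_0_right]
    R_alpha R_beta S_alpha S_beta
  \<comment> \<open>Both the Rota-Baxter identities and the images of sums in the axioms are distributed over the
    summands, so that they agree up to reordering of sums.\<close>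
  note rb = R_prec[unfolded map_R_add] R_succ[unfolded map_R_add]
    S_prec[unfolded map_S_add] S_succ[unfolded map_S_add]
  note sesquilinear =
    prec.conformal_sesquilinear_twist_right[OF hom_S]
    prec.conformal_sesquilinear_twist_left[OF hom_R]
    succ.conformal_sesquilinear_twist_right[OF hom_S]
    succ.conformal_sesquilinear_twist_left[OF hom_R]
  note mults =
    multiplicative_for_twist_right[of _ _ S, OF alpha_mult_prec S_alpha]
    multiplicative_for_twist_left[of _ _ R, OF alpha_mult_prec R_alpha]
    multiplicative_for_twist_right[of _ _ S, OF alpha_mult_succ S_alpha]
    multiplicative_for_twist_left[of _ _ R, OF alpha_mult_succ R_alpha]
    multiplicative_for_twist_right[of _ _ S, OF beta_mult_prec S_beta]
    multiplicative_for_twist_left[of _ _ R, OF beta_mult_prec R_beta]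
    multiplicative_for_twist_right[of _ _ S, OF beta_mult_succ S_beta]
    multiplicative_for_twist_left[of _ _ R, OF beta_mult_succ R_beta]
  show ?thesis
  proof (intro bihom_quadri_conformal_algebra.intro bihom_quadri_conformal_algebra_axioms.intro)
    show "bihom_structure_maps scale \<alpha> \<beta>"
      by (rule bihom_structure_maps_axioms)
  next
    fix p q r
    show "lprod (\<lambda>p q. prec p (S q)) (prec p (S q)) (\<beta> r) =
        rprod (\<lambda>p q. prec p (S q)) (\<alpha> p)
          (prec q (S r) + prec (R q) r + succ q (S r) + succ (R q) r)"
      using dendriform1[of p "S q" "S r"] by (simp add: twists rb map_S_add add_ac)
    show "lprod (\<lambda>p q. prec p (S q)) (succ p (S q)) (\<beta> r) =
        rprod (\<lambda>p q. succ p (S q)) (\<alpha> p) (prec q (S r) + prec (R q) r)"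
      using dendriform2[of p "S q" "S r"] by (simp add: twists rb map_S_add)
    show "lprod (\<lambda>p q. succ p (S q)) (succ p (S q) + prec p (S q)) (\<beta> r) =
        rprod (\<lambda>p q. succ p (S q)) (\<alpha> p) (succ q (S r) + succ (R q) r)"
      using dendriform3[of p "S q" "S r"] by (simp add: twists rb map_S_add add_ac)
    show "lprod (\<lambda>p q. prec p (S q)) (prec (R p) q) (\<beta> r) =
        rprod (\<lambda>p q. prec (R p) q) (\<alpha> p) (succ q (S r) + prec q (S r))"
      using dendriform1[of "R p" q "S r"] by (simp add: twists add_ac)
    show "lprod (\<lambda>p q. succ p (S q)) (succ (R p) q + prec (R p) q) (\<beta> r) =
        rprod (\<lambda>p q. succ (R p) q) (\<alpha> p) (succ q (S r))"
      using dendriform3[of "R p" q "S r"] by (simp add: twists add_ac)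
    show "lprod (\<lambda>p q. prec p (S q)) (succ (R p) q) (\<beta> r) =
        rprod (\<lambda>p q. succ (R p) q) (\<alpha> p) (prec q (S r))"
      using dendriform2[of "R p" q "S r"] by (simp add: twists)
    show "lprod (\<lambda>p q. prec (R p) q) (prec p (S q) + prec (R p) q) (\<beta> r) =
        rprod (\<lambda>p q. prec (R p) q) (\<alpha> p) (succ (R q) r + prec (R q) r)"
      using dendriform1[of "R p" "R q" r] by (simp add: twists rb map_R_add add_ac)
    show "lprod (\<lambda>p q. succ (R p) q)
          (prec p (S q) + prec (R p) q + succ p (S q) + succ (R p) q) (\<beta> r) =
        rprod (\<lambda>p q. succ (R p) q) (\<alpha> p) (succ (R q) r)"
      using dendriform3[of "R p" "R q" r] by (simp add: twists rb map_R_add add_ac)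
    show "lprod (\<lambda>p q. prec (R p) q) (succ p (S q) + succ (R p) q) (\<beta> r) =
        rprod (\<lambda>p q. succ (R p) q) (\<alpha> p) (prec (R q) r)"
      using dendriform2[of "R p" "R q" r] by (simp add: twists rb map_R_add)
  qed (fact sesquilinear mults)+
qed

end
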